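(* Let $m\ge 2$, let $B_m$ be a bouquet of $m$ cycles, and let $b$ be the number of the cycles of $B_m$ isomorphic to $C_3$. Then $$\mathrm{cdim}(B_m)=\begin{cases} m+1 & \text{if } b=m,\\ 2m-b & \text{if } b\neq m.\end{cases}$$
   Context: A bouquet $B_m$ of $m$ cycles is the vertex sum of $m$ cycles (each of length at least three) at one common vertex, i.e. the graph obtained from $m$ disjoint cycles by identifying one vertex of each into a single vertex. A set $S\subseteq V(G)$ is a resolving set of a connected graph $G$ if for every pair of distinct vertices $x,y$ of $G$ there is $z\in S$ with $d(x,z)\ne d(y,z)$ ($d$ is the shortest-path distance); it is a connected resolving set if moreover the induced subgraph $G[S]$ is connected. $\mathrm{cdim}(G)$ is the minimum cardinality of a connected resolving set of $G$. *)

theory Defs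
  imports "Graph_Theory.Graph_Theory" "HOL-Library.Disjoint_Sets"
begin

text \<open>
  Undirected graphs are represented, as in the Graph_Theory library, by symmetric digraphs:
  an edge is a pair of opposite arcs.
\<close>

subsection \<open>Connected metric dimension\<close>

definition gdist :: "('a, 'b) pre_digraph \<Rightarrow> 'a \<Rightarrow> 'a \<Rightarrow> ereal" where
  "gdist G u v = wf_digraph.\<mu> G (\<lambda>_. 1) u v"

definition resolving_set :: "('a, 'b) pre_digraph \<Rightarrow> 'a set \<Rightarrow> bool" where
  "resolving_set G S \<longleftrightarrow> S \<subseteq> verts G \<and>
     (\<forall>x\<in>verts G. \<forall>y\<in>verts G. x \<noteq> y \<longrightarrow> (\<exists>z\<in>S. gdist G x z \<noteq> gdist G y z))"

definition connected_resolving_set :: "('a, 'b) pre_digraph \<Rightarrow> 'a set \<Rightarrow> bool" where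
  "connected_resolving_set G S \<longleftrightarrow>
     resolving_set G S \<and> Digraph_Component.connected (G \<restriction> S)"

text \<open>Meaningful for finite connected graphs, where the whole vertex set is such a set \<open>S\<close>.\<close>

definition cdim :: "('a, 'b) pre_digraph \<Rightarrow> nat" where
  "cdim G = (LEAST k. \<exists>S. finite S \<and> connected_resolving_set G S \<and> card S = k)"

subsection \<open>Bouquets of cycles\<close>

text \<open>The cycle \<open>C\<^sub>n\<close>; a simple graph with \<open>n\<close> edges only for \<open>n \<ge> 3\<close>.\<close>

definition cycle_graph :: "nat \<Rightarrow> nat pair_pre_digraph" where
  "cycle_graph n = \<lparr> pverts = {..<n},
     parcs = {(i, j). i < n \<and> j < n \<and> (j = Suc i mod n \<or> i = Suc j mod n)} \<rparr>"

text \<open>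
  The vertex sum of the graphs \<open>C 0, \<dots>, C (m - 1)\<close> at their vertices \<open>r 0, \<dots>, r (m - 1)\<close>:
  all the \<open>r i\<close> are identified, with \<open>r 0\<close> serving as the name of the resulting vertex.
\<close>

definition glue :: "nat \<Rightarrow> (nat \<Rightarrow> 'a) \<Rightarrow> 'a \<Rightarrow> 'a" where
  "glue m r v = (if v \<in> r ` {..<m} then r 0 else v)"

definition vertex_sum ::
    "nat \<Rightarrow> (nat \<Rightarrow> 'a pair_pre_digraph) \<Rightarrow> (nat \<Rightarrow> 'a) \<Rightarrow> 'a pair_pre_digraph" where
  "vertex_sum m C r = \<lparr> pverts = glue m r ` (\<Union>i<m. pverts (C i)),
     parcs = map_prod (glue m r) (glue m r) ` (\<Union>i<m. parcs (C i)) \<rparr>"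

text \<open>\<open>B\<close> is, up to isomorphism, the bouquet of the \<open>m\<close> disjoint cycles \<open>C i\<close> glued at the \<open>r i\<close>.\<close>

definition bouquet ::
    "('b, 'c) pre_digraph \<Rightarrow> nat \<Rightarrow> (nat \<Rightarrow> 'a pair_pre_digraph) \<Rightarrow> (nat \<Rightarrow> 'a) \<Rightarrow> bool" where
  "bouquet B m C r \<longleftrightarrow>
     (\<forall>i<m. \<exists>n\<ge>3. digraph_iso (with_proj (C i)) (with_proj (cycle_graph n))) \<and>
     disjoint_family_on (\<lambda>i. pverts (C i)) {..<m} \<and>
     (\<forall>i<m. r i \<in> pverts (C i)) \<and>
     digraph_iso (with_proj (vertex_sum m C r)) B"

end

theory Submission
  imports Defs
begin

text \<open>
  Call the cycles of the bouquet without the common vertex its petals, and call a cycle long if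
  it is not a triangle. With \<open>l\<close> the number of long cycles, both cases of the formula read
  \<open>m + 1 + (l - 1)\<close>, where the subtraction is truncated: \<open>l = m - b\<close>.

  Lower bound. The two neighbours of the centre on one cycle are at the same distance from
  every vertex outside the petal of that cycle, so a resolving set \<open>S\<close> meets all petals
  (\<open>resolving_meets_petal\<close>). A petal can be left only through the centre. Hence, if \<open>S\<close> is also
  connected, then, as \<open>m \<ge> 2\<close>, it contains the centre and in each petal a neighbour of the centre
  (\<open>connected_resolving_set_near_centre\<close>). Suppose \<open>S\<close> meets two long petals in one vertex each.
  That vertex is a neighbour of the centre, and the opposite neighbour is at distance 2 from it,
  just as if the shortest path went through the centre. So the two opposite
  neighbours look alike from all of \<open>S\<close>. Therefore all long petals but at most one contribute two
  vertices (\<open>long_petals_with_one_vertex\<close>), and \<open>connected_resolving_set_card_ge\<close> counts.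

  Upper bound. The centre, one neighbour of it on every cycle and the second neighbour on every
  long cycle except one form a star. The centre together with one of its neighbours
  separates the vertices of a cycle. For vertices on different petals, one of the
  two petals is not the exceptional one; its vertex has a chosen neighbour of the centre that is
  not farther from it than the centre is, whereas from all other petals this neighbour is
  farther than the centre (\<open>ex_connected_resolving_set\<close>).

  Both arguments take place in coordinates: the vertex \<open>q i j\<close> is number \<open>j\<close> on cycle \<open>i\<close>, counted
  from the centre. The locale \<open>labelled_bouquet\<close> collects what such coordinates satisfy,
  \<open>gdist_q\<close> computes all distances in them, and \<open>bouquet_labelling\<close> shows that every bouquet has them.
\<close>

section \<open>Distances and connectivity in digraphs\<close>

text \<open>
  A candidate for the distance to \<open>z\<close> is correct if it is a potential: no arc lowers it by more
  than one, so every walk to \<open>z\<close> is at least that long, and away from \<open>z\<close> some arc lowers it by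
  exactly one, so following such arcs gives a walk of that length.
\<close>

lemma gdist_eqI:
  fixes h :: "'a \<Rightarrow> nat"
  assumes "wf_digraph G"
    and "u \<in> verts G"
    and target: "h z = 0"
    and unique: "\<And>v. v \<in> verts G \<Longrightarrow> h v = 0 \<Longrightarrow> v = z"
    and lipschitz: "\<And>v w. (v, w) \<in> arcs_ends G \<Longrightarrow> h v \<le> Suc (h w)"
    and descent: "\<And>v. v \<in> verts G \<Longrightarrow> 0 < h v \<Longrightarrow> \<exists>w. (v, w) \<in> arcs_ends G \<and> h v = Suc (h w)"
  shows "gdist G u z = ereal (real (h u))"
proof -
  interpret wf_digraph G by fact
  have cost: "awalk_cost (\<lambda>_. 1) p = real (length p)" for p :: "'b awalk"
    by (induction p) auto
  have lower: "h v \<le> length p" if "awalk v p z" for v p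
    using that
  proof (induction p arbitrary: v)
    case Nil
    then show ?case using target by (simp add: awalk_Nil_iff)
  next
    case (Cons e p)
    then have "e \<in> arcs G" "tail G e = v" "awalk (head G e) p z"
      by (auto simp: awalk_Cons_iff)
    moreover have "(v, head G e) \<in> arcs_ends G"
      using calculation by (auto simp: arcs_ends_conv)
    ultimately show ?case
      using Cons.IH[of "head G e"] lipschitz[of v "head G e"] by simp
  qed
  have upper: "\<exists>p. awalk v p z \<and> length p = k" if "v \<in> verts G" "h v = k" for v k
    using that
  proof (induction k arbitrary: v)
    case 0
    then have "awalk v [] z" using unique[of v] by (auto simp: awalk_Nil_iff)
    then show ?case by auto
  next
    case (Suc k)
    then obtain w where w: "(v, w) \<in> arcs_ends G" "h w = k"
      using descent[of v] by auto
    then obtain e where e: "e \<in> arcs G" "tail G e = v" "head G e = w"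
      by (auto simp: arcs_ends_conv)
    then obtain p where "awalk w p z" "length p = k"
      using Suc.IH[of w] w by auto
    then have "awalk v (e # p) z" "length (e # p) = Suc k"
      using e by (auto simp: awalk_Cons_iff)
    then show ?case by blast
  qed
  obtain p where p: "awalk u p z" "length p = h u"
    using upper[OF \<open>u \<in> verts G\<close> refl] by blast
  show ?thesis
    unfolding gdist_def \<mu>_def cost
  proof (rule antisym)
    show "(INF p\<in>{p. awalk u p z}. ereal (real (length p))) \<le> ereal (real (h u))"
      using p by (intro INF_lower2[of p]) auto
    show "ereal (real (h u)) \<le> (INF p\<in>{p. awalk u p z}. ereal (real (length p)))"
      using lower by (intro INF_greatest) auto
  qed
qed

lemma parcs_mk_symmetric_induce:
  "parcs (mk_symmetric (G \<restriction> S)) =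
     {(u, v). u \<in> S \<and> v \<in> S \<and> ((u, v) \<in> arcs_ends G \<or> (v, u) \<in> arcs_ends G)}"
  by (auto simp: mk_symmetric_def arcs_ends_conv)

lemma pverts_mk_symmetric_induce: "pverts (mk_symmetric (G \<restriction> S)) = S"
  by (simp add: mk_symmetric_def)

text \<open>
  A walk inside \<open>S\<close> that starts in \<open>A\<close> and ends outside has to leave \<open>A\<close> by some arc.
\<close>

lemma connected_crossing_arc:
  assumes conn: "Digraph_Component.connected (G \<restriction> S)"
    and "a \<in> A" "A \<subseteq> S" "b \<in> S" "b \<notin> A"
  shows "\<exists>u\<in>A. \<exists>v\<in>S - A. (u, v) \<in> arcs_ends G \<or> (v, u) \<in> arcs_ends G"
proof (rule ccontr)
  assume no_crossing: "\<not> ?thesis"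
  let ?H = "with_proj (mk_symmetric (G \<restriction> S))"
  have "a \<rightarrow>\<^sup>*\<^bsub>?H\<^esub> b"
    using assms unfolding connected_def strongly_connected_def
    by (auto simp: pverts_mk_symmetric_induce)
  then have "(a, b) \<in> (arcs_ends ?H)\<^sup>*" by (rule reachable_rtranclI)
  then have "b \<in> A"
  proof (induction rule: rtrancl_induct)
    case base
    show ?case by fact
  next
    case (step y z)
    then show ?case using no_crossing by (auto simp: parcs_mk_symmetric_induce)
  qed
  then show False using \<open>b \<notin> A\<close> by blast
qed

lemma connected_star:
  assumes "c \<in> S" and star: "\<And>v. v \<in> S \<Longrightarrow> v \<noteq> c \<Longrightarrow> (v, c) \<in> arcs_ends G"
  shows "Digraph_Component.connected (G \<restriction> S)"
proof -
  let ?H = "with_proj (mk_symmetric (G \<restriction> S))"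
  interpret H: wf_digraph ?H
    by unfold_locales (auto simp: pverts_mk_symmetric_induce parcs_mk_symmetric_induce)
  have "v \<rightarrow>\<^sup>*\<^bsub>?H\<^esub> c \<and> c \<rightarrow>\<^sup>*\<^bsub>?H\<^esub> v" if "v \<in> S" for v
  proof (cases "v = c")
    case True
    then show ?thesis using that
      by (auto intro!: H.reachable_refl simp: pverts_mk_symmetric_induce)
  next
    case False
    then have "(v, c) \<in> arcs_ends ?H" "(c, v) \<in> arcs_ends ?H"
      using star[OF that] that \<open>c \<in> S\<close> by (auto simp: parcs_mk_symmetric_induce)
    then show ?thesis by (blast intro: H.reachable_adjI)
  qed
  then have "u \<rightarrow>\<^sup>*\<^bsub>?H\<^esub> v" if "u \<in> S" "v \<in> S" for u v
    using that H.reachable_trans by blast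
  then show ?thesis
    using \<open>c \<in> S\<close> unfolding connected_def strongly_connected_def
    by (auto simp: pverts_mk_symmetric_induce)
qed

lemma cdim_eqI:
  assumes "finite S" "connected_resolving_set G S" "card S \<le> k"
    and "\<And>T. finite T \<Longrightarrow> connected_resolving_set G T \<Longrightarrow> k \<le> card T"
  shows "cdim G = k"
proof -
  have "card S = k" using assms(3) assms(4)[OF assms(1,2)] by (rule le_antisym)
  then show ?thesis
    unfolding cdim_def using assms by (intro Least_equality) auto
qed

section \<open>Distances in a cycle\<close>

definition cyc_adj :: "nat \<Rightarrow> nat \<Rightarrow> nat \<Rightarrow> bool" where
  "cyc_adj n j k \<longleftrightarrow> k = Suc j mod n \<or> j = Suc k mod n"

text \<open>
  The graph distance in the cycle \<open>C\<^sub>n\<close>, for \<open>j, k < n\<close>: the two paths between the positions have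
  the lengths \<open>d\<close> and \<open>n - d\<close>.
\<close>

definition cyc_dist :: "nat \<Rightarrow> nat \<Rightarrow> nat \<Rightarrow> nat" where
  "cyc_dist n j k = (let d = max j k - min j k in min d (n - d))"

lemma Suc_mod_eq: "j < n \<Longrightarrow> Suc j mod n = (if Suc j = n then 0 else Suc j)"
  by auto

lemma cyc_dist_le: "j \<le> k \<Longrightarrow> cyc_dist n j k = min (k - j) (n - (k - j))"
  by (simp add: cyc_dist_def max_def min_def)

lemma cyc_dist_ge: "k \<le> j \<Longrightarrow> cyc_dist n j k = min (j - k) (n - (j - k))"
  by (simp add: cyc_dist_def max_def min_def)

lemma cyc_dist_eq_0_iff: "j < n \<Longrightarrow> k < n \<Longrightarrow> cyc_dist n j k = 0 \<longleftrightarrow> j = k"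
  by (cases j k rule: linorder_cases) (simp_all add: cyc_dist_le cyc_dist_ge min_def)

lemma cyc_dist_Suc:
  assumes "Suc j < n" "l < n"
  shows "cyc_dist n j l \<le> Suc (cyc_dist n (Suc j) l) \<and> cyc_dist n (Suc j) l \<le> Suc (cyc_dist n j l)"
proof (cases "j < l")
  case True
  \<comment> \<open>With the gaps \<open>d\<close> and \<open>e\<close> as parameters no truncated subtraction is left.\<close>
  obtain d where d: "l = Suc (j + d)" using less_imp_Suc_add[OF True] by blast
  obtain e where e: "n = Suc (l + e)" using less_imp_Suc_add[OF assms(2)] by blast
  have "cyc_dist n j l = min (Suc d) (Suc (j + e))" "cyc_dist n (Suc j) l = min d (Suc (Suc (j + e)))"
    using d e by (simp_all add: cyc_dist_le)
  then show ?thesis by (simp add: min_def)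
next
  case False
  then obtain d where d: "j = l + d" by (auto simp: not_less le_iff_add)
  obtain e where e: "n = Suc (Suc j + e)" using less_imp_Suc_add[OF assms(1)] by blast
  have "cyc_dist n j l = min d (Suc (Suc (l + e)))" "cyc_dist n (Suc j) l = min (Suc d) (Suc (l + e))"
    using d e by (simp_all add: cyc_dist_ge)
  then show ?thesis by (simp add: min_def)
qed

lemma cyc_dist_wrap:
  assumes "l < n"
  shows "cyc_dist n (n - 1) l \<le> Suc (cyc_dist n 0 l) \<and> cyc_dist n 0 l \<le> Suc (cyc_dist n (n - 1) l)"
proof -
  obtain d where d: "n = Suc (l + d)" using less_imp_Suc_add[OF assms] by blast
  have "cyc_dist n (n - 1) l = min d (Suc l)" "cyc_dist n 0 l = min l (Suc d)"
    using d by (simp_all add: cyc_dist_le cyc_dist_ge)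
  then show ?thesis by (simp add: min_def)
qed

lemma cyc_dist_step:
  assumes "j < n" "k < n" "l < n" "cyc_adj n j k"
  shows "cyc_dist n j l \<le> Suc (cyc_dist n k l)"
proof -
  have "k = Suc j \<or> j = Suc k \<or> j = n - 1 \<and> k = 0 \<or> k = n - 1 \<and> j = 0"
    using assms by (auto simp: cyc_adj_def Suc_mod_eq split: if_splits)
  then show ?thesis
    using assms(1-3) cyc_dist_Suc cyc_dist_wrap by blast
qed

lemma cyc_dist_descent:
  assumes "j < n" "l < n" "j \<noteq> l"
  shows "\<exists>k<n. cyc_adj n j k \<and> cyc_dist n j l = Suc (cyc_dist n k l)"
proof -
  define s where "s = (if Suc j = n then 0 else Suc j)"
  define p where "p = (if j = 0 then n - 1 else j - 1)"
  have adj: "cyc_adj n j s" "cyc_adj n j p" "s < n" "p < n"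
    using assms by (auto simp: s_def p_def cyc_adj_def Suc_mod_eq)
  have "cyc_dist n j l = Suc (cyc_dist n s l) \<or> cyc_dist n j l = Suc (cyc_dist n p l)"
  proof (cases "j < l")
    case True
    then have "s = Suc j" using assms by (simp add: s_def)
    obtain d where d: "l = Suc (j + d)" using less_imp_Suc_add[OF True] by blast
    obtain e where e: "n = Suc (l + e)" using less_imp_Suc_add[OF \<open>l < n\<close>] by blast
    have "cyc_dist n j l = min (Suc d) (Suc (j + e))" "cyc_dist n s l = min d (Suc (Suc (j + e)))"
      using d e \<open>s = Suc j\<close> by (simp_all add: cyc_dist_le)
    moreover have "cyc_dist n p l = (if j = 0 then min e (Suc (Suc d)) else min (Suc (Suc d)) (j + e))"
      using d e by (simp add: p_def cyc_dist_ge cyc_dist_le)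
    ultimately show ?thesis by (simp add: min_def)
  next
    case False
    then have "l < j" "p = j - 1" using assms by (auto simp: p_def)
    obtain d where d: "j = Suc (l + d)" using less_imp_Suc_add[OF \<open>l < j\<close>] by blast
    obtain e where e: "n = Suc (j + e)" using less_imp_Suc_add[OF \<open>j < n\<close>] by blast
    have "cyc_dist n j l = min (Suc d) (Suc (l + e))" "cyc_dist n p l = min d (Suc (Suc (l + e)))"
      using d e \<open>p = j - 1\<close> by (simp_all add: cyc_dist_ge)
    moreover have "cyc_dist n s l = (if e = 0 then min l (Suc (Suc d)) else min (Suc (Suc d)) (l + e))"
      using d e by (simp add: s_def cyc_dist_ge cyc_dist_le)
    ultimately show ?thesis by (simp add: min_def)
  qed
  then show ?thesis using adj by blast
qed

text \<open>
  Two adjacent vertices resolve a cycle: the distance to 0 determines a position up to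
  reflection, and of two distinct mirror images one is nearer to 1 than the other.
\<close>

lemma cyc_dist_resolving_pair:
  assumes "j < n" "k < n"
    and "cyc_dist n j 0 = cyc_dist n k 0" "cyc_dist n j 1 = cyc_dist n k 1"
  shows "j = k"
proof (cases "j = 0 \<or> k = 0")
  case True
  have "cyc_dist n j 0 = 0 \<longleftrightarrow> j = 0" "cyc_dist n k 0 = 0 \<longleftrightarrow> k = 0"
    using assms(1,2) by (auto intro!: cyc_dist_eq_0_iff)
  then show ?thesis using True assms(3) by linarith
next
  case False
  obtain j' where j': "j = Suc j'" using False by (cases j) auto
  obtain k' where k': "k = Suc k'" using False by (cases k) auto
  obtain d where d: "n = Suc (j + d)" using less_imp_Suc_add[OF assms(1)] by blast
  obtain e where e: "n = Suc (k + e)" using less_imp_Suc_add[OF assms(2)] by blast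
  have "cyc_dist n j 0 = min (Suc j') (Suc d)" "cyc_dist n j 1 = min j' (Suc (Suc d))"
    using j' d by (simp_all add: cyc_dist_ge)
  moreover have "cyc_dist n k 0 = min (Suc k') (Suc e)" "cyc_dist n k 1 = min k' (Suc (Suc e))"
    using k' e by (simp_all add: cyc_dist_ge)
  ultimately have "j' = k' \<or> d = e"
    using assms(3,4) by (cases "j' \<le> d"; cases "k' \<le> e") (simp_all add: min_def split: if_splits)
  then show ?thesis using j' k' d e by auto
qed

text \<open>
  The reflection \<open>N - x\<close> of a neighbour \<open>x\<close> of 0 is the other neighbour of 0. The last claim fails
  for the triangle, where the two neighbours are adjacent; this is what sets triangles apart.
\<close>

lemma opposite_neighbours:
  assumes "3 \<le> N" "x = 1 \<or> x = N - 1"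
  shows "N - x < N" "N - x \<noteq> x" "N - x \<noteq> 0" "cyc_dist N (N - x) 0 = 1"
    and "4 \<le> N \<Longrightarrow> cyc_dist N (N - x) x = 2"
proof -
  obtain d where d: "N = Suc (Suc (Suc d))"
    using \<open>3 \<le> N\<close> by (metis add_2_eq_Suc add_Suc le_Suc_ex numeral_3_eq_3 plus_1_eq_Suc)
  show "N - x < N" "N - x \<noteq> x" "N - x \<noteq> 0" "cyc_dist N (N - x) 0 = 1"
    using assms d by (auto simp: cyc_dist_ge)
  show "cyc_dist N (N - x) x = 2" if "4 \<le> N"
    using assms d that by (auto simp: cyc_dist_ge cyc_dist_le)
qed

lemma cyc_dist_nearer_neighbour:
  assumes "0 < j" "j < N"
  shows "cyc_dist N j 1 < cyc_dist N j 0 \<or> cyc_dist N j (N - 1) < cyc_dist N j 0"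
proof -
  obtain d where d: "N = Suc (j + d)" using less_imp_Suc_add[OF \<open>j < N\<close>] by blast
  obtain j' where j': "j = Suc j'" using \<open>0 < j\<close> by (cases j) auto
  have "cyc_dist N j 0 = min (Suc j') (Suc d)" "cyc_dist N j 1 = min j' (Suc (Suc d))"
    "cyc_dist N j (N - 1) = min d (Suc (Suc j'))"
    using d j' by (simp_all add: cyc_dist_ge cyc_dist_le)
  then show ?thesis by (simp add: min_def)
qed

text \<open>
  This is why one chosen vertex suffices in the petal of a triangle: position 2 is adjacent to 1
  as well as to 0. On longer cycles both neighbours of 0 are needed for such an inequality.
\<close>

lemma cyc_dist_triangle:
  assumes "0 < j" "j < 3"
  shows "cyc_dist 3 j 1 \<le> cyc_dist 3 j 0"
proof -
  have "j = 1 \<or> j = 2" using assms by auto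
  then show ?thesis by (auto simp: cyc_dist_ge)
qed

section \<open>Bouquets in coordinates\<close>

text \<open>
  Coordinates on a bouquet: \<open>q i j\<close> is the vertex at position \<open>j\<close> of the cycle number \<open>i\<close>, whose
  length is \<open>n i\<close>. All positions 0 denote the same vertex, and this is the only ambiguity.
\<close>

locale labelled_bouquet = wf_digraph G for G :: "('b, 'c) pre_digraph" +
  fixes m :: nat and n :: "nat \<Rightarrow> nat" and q :: "nat \<Rightarrow> nat \<Rightarrow> 'b"
  assumes two_le_m: "2 \<le> m"
    and three_le_n: "i < m \<Longrightarrow> 3 \<le> n i"
    and verts_eq: "verts G = {q i j | i j. i < m \<and> j < n i}"
    and q_eq_iff: "\<lbrakk>i < m; j < n i; i' < m; j' < n i'\<rbrakk> \<Longrightarrow>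
      q i j = q i' j' \<longleftrightarrow> j = j' \<and> (i = i' \<or> j = 0)"
    and arcs_ends_eq: "arcs_ends G =
      {(q i j, q i k) | i j k. i < m \<and> j < n i \<and> k < n i \<and> cyc_adj (n i) j k}"
begin

definition centre :: 'b where
  "centre = q 0 0"

definition petal :: "nat \<Rightarrow> 'b set" where
  "petal i = q i ` {1..<n i}"

definition long :: "nat set" where
  "long = {i. i < m \<and> n i \<noteq> 3}"

lemma n_pos [simp]: "i < m \<Longrightarrow> 0 < n i"
  using three_le_n[of i] by simp

lemma q_0: "i < m \<Longrightarrow> q i 0 = centre"
  unfolding centre_def using two_le_m by (subst q_eq_iff) auto

lemma q_in_verts: "i < m \<Longrightarrow> j < n i \<Longrightarrow> q i j \<in> verts G"
  by (auto simp: verts_eq)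

lemma vertsE:
  assumes "v \<in> verts G"
  obtains i j where "i < m" "j < n i" "v = q i j"
  using assms by (auto simp: verts_eq)

text \<open>
  Distances within a cycle are those of the cycle, since a detour through another cycle has to
  come back to the centre; between different cycles, the shortest path runs through the centre.
  The proof checks that this value, as a function of the first vertex, is a potential.
\<close>

lemma gdist_q:
  assumes "i < m" "j < n i" "i' < m" "k < n i'"
  shows "gdist G (q i j) (q i' k) = ereal (real
    (if i = i' then cyc_dist (n i) j k else cyc_dist (n i) j 0 + cyc_dist (n i') 0 k))"
proof -
  \<comment> \<open>\<open>D\<close> is the claimed distance in coordinates; \<open>h\<close> transports it to vertices, which is possible
      because all coordinates of the centre give the same value.\<close>
  define D where "D i j = (if i = i' then cyc_dist (n i') j k
    else cyc_dist (n i) j 0 + cyc_dist (n i') 0 k)" for i j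
  define h where "h v = (SOME d. \<exists>i<m. \<exists>j<n i. v = q i j \<and> d = D i j)" for v
  have D_0: "D i 0 = cyc_dist (n i') 0 k" if "i < m" for i
    using that by (simp add: D_def cyc_dist_eq_0_iff)
  have D_unique: "D i j = D i2 j2"
    if "i < m" "j < n i" "i2 < m" "j2 < n i2" "q i j = q i2 j2" for i j i2 j2
    using that q_eq_iff[of i j i2 j2] D_0 by auto
  have h_q: "h (q i j) = D i j" if "i < m" "j < n i" for i j
    unfolding h_def
  proof (rule some_equality)
    show "\<exists>i2<m. \<exists>j2<n i2. q i j = q i2 j2 \<and> D i j = D i2 j2" using that by blast
  next
    fix d assume "\<exists>i2<m. \<exists>j2<n i2. q i j = q i2 j2 \<and> d = D i2 j2"
    then show "d = D i j" using D_unique that by metis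
  qed
  have "gdist G (q i j) (q i' k) = ereal (real (h (q i j)))"
  proof (rule gdist_eqI[OF wf_digraph q_in_verts[OF assms(1,2)]])
    show "h (q i' k) = 0"
      using assms by (simp add: h_q D_def cyc_dist_eq_0_iff)
  next
    fix v assume "v \<in> verts G" "h v = 0"
    then obtain a b where ab: "a < m" "b < n a" "v = q a b" by (elim vertsE)
    then have "D a b = 0" using \<open>h v = 0\<close> by (simp add: h_q)
    then have "if a = i' then b = k else b = 0 \<and> k = 0"
      using ab assms cyc_dist_eq_0_iff[of b "n a" k] cyc_dist_eq_0_iff[of b "n a" 0]
        cyc_dist_eq_0_iff[of 0 "n i'" k]
      by (auto simp: D_def split: if_splits)
    then show "v = q i' k"
      using ab assms by (auto simp: q_0 split: if_splits)
  next
    fix v w assume "(v, w) \<in> arcs_ends G"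
    then obtain a b c where abc: "a < m" "b < n a" "c < n a" "cyc_adj (n a) b c"
      and vw: "v = q a b" "w = q a c"
      by (auto simp: arcs_ends_eq)
    have "D a b \<le> Suc (D a c)"
      using cyc_dist_step[OF abc(2,3) _ abc(4), of k] cyc_dist_step[OF abc(2,3) _ abc(4), of 0]
        abc assms by (auto simp: D_def)
    then show "h v \<le> Suc (h w)" using abc vw by (simp add: h_q)
  next
    fix v assume "v \<in> verts G" "0 < h v"
    then obtain a b where ab: "a < m" "b < n a" "v = q a b" by (elim vertsE)
    then have pos: "0 < D a b" using \<open>0 < h v\<close> by (simp add: h_q)
    \<comment> \<open>The coordinates of \<open>v\<close> may have to change: the centre must be seen as a vertex of the target
        cycle, since it is there that the distance decreases.\<close>
    have "\<exists>a b c. a < m \<and> b < n a \<and> c < n a \<and> v = q a b \<and> cyc_adj (n a) b c \<and> D a b = Suc (D a c)"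
    proof (cases "a = i' \<or> b = 0")
      case True
      then have v: "v = q i' b" "b < n i'" "D i' b = D a b"
        using ab assms D_0 by (auto simp: q_0)
      then have "b \<noteq> k"
        using pos assms cyc_dist_eq_0_iff[of b "n i'" k] by (auto simp: D_def)
      then obtain c where "c < n i'" "cyc_adj (n i') b c"
        "cyc_dist (n i') b k = Suc (cyc_dist (n i') c k)"
        using cyc_dist_descent[OF v(2) assms(4)] by blast
      then show ?thesis
        using v assms by (intro exI[of _ i'] exI[of _ b] exI[of _ c]) (simp add: D_def)
    next
      case False
      then obtain c where "c < n a" "cyc_adj (n a) b c"
        "cyc_dist (n a) b 0 = Suc (cyc_dist (n a) c 0)"
        using cyc_dist_descent[of b "n a" 0] ab by auto
      then show ?thesis
        using ab False by (intro exI[of _ a] exI[of _ b] exI[of _ c]) (simp add: D_def)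
    qed
    then obtain a b c where "a < m" "b < n a" "c < n a" "v = q a b"
      "cyc_adj (n a) b c" "D a b = Suc (D a c)" by blast
    then have "(v, q a c) \<in> arcs_ends G" "h v = Suc (h (q a c))"
      by (auto simp: arcs_ends_eq h_q)
    then show "\<exists>w. (v, w) \<in> arcs_ends G \<and> h v = Suc (h w)" by blast
  qed
  then show ?thesis using assms by (simp add: h_q D_def)
qed

lemma gdist_same_cycle:
  "i < m \<Longrightarrow> j < n i \<Longrightarrow> k < n i \<Longrightarrow> gdist G (q i j) (q i k) = ereal (real (cyc_dist (n i) j k))"
  by (simp add: gdist_q)

lemma gdist_across:
  "i < m \<Longrightarrow> j < n i \<Longrightarrow> i' < m \<Longrightarrow> k < n i' \<Longrightarrow> i \<noteq> i' \<or> k = 0 \<Longrightarrow>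
   gdist G (q i j) (q i' k) = ereal (real (cyc_dist (n i) j 0 + cyc_dist (n i') 0 k))"
  by (auto simp: gdist_q cyc_dist_eq_0_iff)

subsection \<open>The lower bound\<close>

text \<open>
  Only a vertex of the petal itself distinguishes the two neighbours of the centre on a cycle.
\<close>

lemma resolving_meets_petal:
  assumes "resolving_set G S" "i < m"
  shows "S \<inter> petal i \<noteq> {}"
proof -
  have N: "3 \<le> n i" using three_le_n[OF \<open>i < m\<close>] .
  have "q i 1 \<noteq> q i (n i - 1)" "q i 1 \<in> verts G" "q i (n i - 1) \<in> verts G"
    using N \<open>i < m\<close> by (auto simp: q_eq_iff q_in_verts)
  then obtain z where z: "z \<in> S" "gdist G (q i 1) z \<noteq> gdist G (q i (n i - 1)) z"
    using assms(1) unfolding resolving_set_def by blast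
  then have "z \<in> verts G" using assms(1) unfolding resolving_set_def by blast
  then obtain l k where lk: "l < m" "k < n l" "z = q l k" by (elim vertsE)
  have "cyc_dist (n i) 1 0 = 1" "cyc_dist (n i) (n i - 1) 0 = 1"
    using N opposite_neighbours(4)[of "n i" 1] opposite_neighbours(4)[of "n i" "n i - 1"] by auto
  then have "\<not> (l \<noteq> i \<or> k = 0)"
    using z(2) lk N \<open>i < m\<close> gdist_across[of i 1 l k] gdist_across[of i "n i - 1" l k] by fastforce
  then have "z \<in> petal i" using lk by (auto simp: petal_def)
  then show ?thesis using z(1) by blast
qed

lemma petals_disjoint:
  assumes "i < m" "i' < m" "i \<noteq> i'"
  shows "petal i \<inter> petal i' = {}"
  using assms by (auto simp: petal_def q_eq_iff)

lemma centre_notin_petal: "i < m \<Longrightarrow> centre \<notin> petal i"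
  using two_le_m by (auto simp: petal_def centre_def q_eq_iff)

lemma arc_leaving_petal:
  assumes "i < m" "u \<in> petal i" "v \<notin> petal i"
    and "(u, v) \<in> arcs_ends G \<or> (v, u) \<in> arcs_ends G"
  shows "v = centre" "u = q i 1 \<or> u = q i (n i - 1)"
proof -
  obtain a j k where ajk: "a < m" "j < n a" "k < n a" "u = q a j" "v = q a k"
    "cyc_adj (n a) j k"
    using assms(4) by (auto simp: arcs_ends_eq cyc_adj_def)
  obtain j' where j': "u = q i j'" "0 < j'" "j' < n i"
    using assms(2) by (auto simp: petal_def)
  have "a = i \<and> j = j'" using ajk j' q_eq_iff[of a j i j'] \<open>i < m\<close> by auto
  then have "k = 0" using ajk assms(3) by (auto simp: petal_def)
  then show "v = centre" using ajk by (simp add: q_0)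
  have "j = 1 \<or> j = n i - 1"
    using ajk \<open>a = i \<and> j = j'\<close> \<open>k = 0\<close> j' by (auto simp: cyc_adj_def Suc_mod_eq split: if_splits)
  then show "u = q i 1 \<or> u = q i (n i - 1)" using ajk \<open>a = i \<and> j = j'\<close> by auto
qed

text \<open>
  As there is a second petal that \<open>S\<close> meets, the connected set \<open>S\<close> has an arc leaving the
  petal of the cycle \<open>i\<close>. Its ends are the two vertices claimed to lie in \<open>S\<close>.
\<close>

lemma connected_resolving_set_near_centre:
  assumes "connected_resolving_set G S" "i < m"
  shows "centre \<in> S" "\<exists>x. (x = 1 \<or> x = n i - 1) \<and> q i x \<in> S"
proof -
  have res: "resolving_set G S" and conn: "Digraph_Component.connected (G \<restriction> S)"
    using assms(1) by (auto simp: connected_resolving_set_def)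
  obtain a where a: "a \<in> S \<inter> petal i" using resolving_meets_petal[OF res assms(2)] by blast
  obtain i' where i': "i' < m" "i' \<noteq> i"
    using two_le_m that[of "if i = 0 then 1 else 0"] by (auto split: if_splits)
  then obtain b where b: "b \<in> S" "b \<in> petal i'" using resolving_meets_petal[OF res] by blast
  then have "b \<notin> S \<inter> petal i" using petals_disjoint i' assms(2) by blast
  then obtain u v where uv: "u \<in> S \<inter> petal i" "v \<in> S - S \<inter> petal i"
    "(u, v) \<in> arcs_ends G \<or> (v, u) \<in> arcs_ends G"
    using connected_crossing_arc[OF conn a _ b(1)] by blast
  then have "v = centre" "u = q i 1 \<or> u = q i (n i - 1)"
    using arc_leaving_petal[of i u v] assms(2) by auto
  then show "centre \<in> S" "\<exists>x. (x = 1 \<or> x = n i - 1) \<and> q i x \<in> S" using uv by auto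
qed

text \<open>
  The vertices \<open>q i x'\<close> and \<open>q i' y'\<close> opposite to the only chosen ones of the two petals would not be
  resolved: both are at distance 1 from the centre and, as the cycles are long, at distance 2
  from both chosen vertices.
\<close>

lemma long_petals_with_one_vertex:
  assumes crs: "connected_resolving_set G S"
    and i: "i \<in> long" "card (S \<inter> petal i) = 1"
    and i': "i' \<in> long" "card (S \<inter> petal i') = 1"
  shows "i = i'"
proof (rule ccontr)
  assume "i \<noteq> i'"
  have res: "resolving_set G S" using crs by (simp add: connected_resolving_set_def)
  have single: "\<exists>x. (x = 1 \<or> x = n l - 1) \<and> S \<inter> petal l = {q l x}"
    if "l \<in> long" "card (S \<inter> petal l) = 1" for l
  proof -
    have "l < m" using that by (simp add: long_def)
    obtain x where x: "x = 1 \<or> x = n l - 1" "q l x \<in> S"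
      using connected_resolving_set_near_centre(2)[OF crs \<open>l < m\<close>] by blast
    then have "q l x \<in> S \<inter> petal l"
      using three_le_n[OF \<open>l < m\<close>] by (auto simp: petal_def)
    moreover obtain v where "S \<inter> petal l = {v}" using \<open>card (S \<inter> petal l) = 1\<close> by (rule card_1_singletonE)
    ultimately have "S \<inter> petal l = {q l x}" by simp
    then show ?thesis using x(1) by (intro exI[of _ x]) simp
  qed
  obtain x where x: "x = 1 \<or> x = n i - 1" "S \<inter> petal i = {q i x}" using single[OF i] by blast
  obtain y where y: "y = 1 \<or> y = n i' - 1" "S \<inter> petal i' = {q i' y}" using single[OF i'] by blast
  have m: "i < m" "i' < m" and N: "3 \<le> n i" "3 \<le> n i'" "4 \<le> n i" "4 \<le> n i'"
    using i i' three_le_n[of i] three_le_n[of i'] by (auto simp: long_def)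
  note ox = opposite_neighbours[OF N(1) x(1)] and oy = opposite_neighbours[OF N(2) y(1)]
  define x' y' where "x' = n i - x" and "y' = n i' - y"
  have x': "x' < n i" "x' \<noteq> 0" "cyc_dist (n i) x' 0 = 1" "cyc_dist (n i) x' x = 2"
    and y': "y' < n i'" "y' \<noteq> 0" "cyc_dist (n i') y' 0 = 1" "cyc_dist (n i') y' y = 2"
    using ox oy N by (auto simp: x'_def y'_def)
  have lt: "x < n i" "y < n i'" and d1: "cyc_dist (n i) 0 x = 1" "cyc_dist (n i') 0 y = 1"
    using x(1) y(1) N by (auto simp: cyc_dist_le)
  have "q i x' \<noteq> q i' y'" using m x' y' \<open>i \<noteq> i'\<close> by (auto simp: q_eq_iff)
  then obtain z where z: "z \<in> S" "gdist G (q i x') z \<noteq> gdist G (q i' y') z"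
    using res m x' y' q_in_verts unfolding resolving_set_def by blast
  then have "z \<in> verts G" using res unfolding resolving_set_def by blast
  then obtain l k where lk: "l < m" "k < n l" "z = q l k" by (elim vertsE)
  show False
  proof (cases "k = 0 \<or> l \<noteq> i \<and> l \<noteq> i'")
    case True
    then have "gdist G (q i x') z = gdist G (q i' y') z"
      using lk m x' y' gdist_across[of i x' l k] gdist_across[of i' y' l k] by auto
    then show False using z by blast
  next
    case False
    then have "z \<in> petal l" using lk by (auto simp: petal_def)
    then have "l = i \<and> z = q i x \<or> l = i' \<and> z = q i' y" using False x y z by blast
    then show False
    proof
      assume "l = i \<and> z = q i x"
      then show False
        using z(2) m x' y' lt d1 \<open>i \<noteq> i'\<close> gdist_same_cycle[of i x' x] gdist_across[of i' y' i x] by auto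
    next
      assume "l = i' \<and> z = q i' y"
      then show False
        using z(2) m x' y' lt d1 \<open>i \<noteq> i'\<close> gdist_same_cycle[of i' y' y] gdist_across[of i x' i' y] by auto
    qed
  qed
qed

lemma connected_resolving_set_card_ge:
  assumes "finite S" and crs: "connected_resolving_set G S"
  shows "m + 1 + (card long - 1) \<le> card S"
proof -
  let ?f = "\<lambda>i. card (S \<inter> petal i)"
  define single where "single = {i \<in> long. ?f i = 1}"
  have fin: "finite long" by (simp add: long_def)
  have res: "resolving_set G S" using crs by (simp add: connected_resolving_set_def)
  have pos: "1 \<le> ?f i" if "i < m" for i
    using resolving_meets_petal[OF res that] \<open>finite S\<close> by (simp add: Suc_le_eq card_gt_0_iff)
  have "card single \<le> 1"
    using long_petals_with_one_vertex[OF crs] fin unfolding single_def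
    by (intro card_le_Suc0_iff_eq[THEN iffD2, unfolded One_nat_def[symmetric]]) auto
  then have "card long - 1 \<le> card (long - single)"
    using fin card_Diff_subset[of single long] by (auto simp: single_def finite_subset)
  moreover have "m + card (long - single) \<le> (\<Sum>i<m. ?f i)"
  proof -
    have "{..<m} \<inter> (long - single) = long - single" by (auto simp: long_def)
    then have "m + card (long - single) = (\<Sum>i<m. 1 + of_bool (i \<in> long - single))"
      by (simp add: sum.distrib of_bool_def sum.If_cases del: Diff_iff One_nat_def sum_Suc plus_1_eq_Suc)
    also have "\<dots> \<le> (\<Sum>i<m. ?f i)"
    proof (rule sum_mono)
      fix i assume "i \<in> {..<m}"
      then show "1 + of_bool (i \<in> long - single) \<le> ?f i"
        using pos[of i] by (auto simp: single_def)
    qed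
    finally show ?thesis .
  qed
  moreover have "1 + (\<Sum>i<m. ?f i) \<le> card S"
  proof -
    have "(\<Sum>i<m. ?f i) = card (\<Union>i<m. S \<inter> petal i)"
      using \<open>finite S\<close> petals_disjoint by (intro card_UN_disjoint[symmetric]) auto
    moreover have "centre \<notin> (\<Union>i<m. S \<inter> petal i)" using centre_notin_petal by blast
    ultimately have "1 + (\<Sum>i<m. ?f i) = card (insert centre (\<Union>i<m. S \<inter> petal i))"
      using \<open>finite S\<close> by (subst card_insert_disjoint) auto
    also have "\<dots> \<le> card S"
      using \<open>finite S\<close> connected_resolving_set_near_centre(1)[OF crs, of 0] two_le_m
      by (intro card_mono) auto
    finally show ?thesis .
  qed
  ultimately show ?thesis by linarith
qed

subsection \<open>The upper bound\<close>

lemma same_cycle_resolved: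
  assumes "i < m" "j < n i" "k < n i" "q i j \<noteq> q i k" "centre \<in> S" "q i 1 \<in> S"
  shows "\<exists>z\<in>S. gdist G (q i j) z \<noteq> gdist G (q i k) z"
proof -
  have "cyc_dist (n i) j 0 \<noteq> cyc_dist (n i) k 0 \<or> cyc_dist (n i) j 1 \<noteq> cyc_dist (n i) k 1"
    using cyc_dist_resolving_pair[of j "n i" k] assms three_le_n[of i] by blast
  then have "gdist G (q i j) (q i 0) \<noteq> gdist G (q i k) (q i 0) \<or>
    gdist G (q i j) (q i 1) \<noteq> gdist G (q i k) (q i 1)"
    using assms three_le_n[of i] by (simp add: gdist_same_cycle)
  then show ?thesis using assms q_0[of i] by auto
qed

text \<open>
  Going from the centre to \<open>q i a\<close> does not increase the distance to the vertex on cycle \<open>i\<close> but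
  increases the distance to the vertex on cycle \<open>i'\<close> by one. So one of the two resolves them.
\<close>

lemma different_cycles_resolved:
  assumes "i < m" "j < n i" "i' < m" "k < n i'" "i \<noteq> i'"
    and "centre \<in> S" "q i a \<in> S" "a < n i"
    and "cyc_dist (n i) j a \<le> cyc_dist (n i) j 0" "cyc_dist (n i) 0 a = 1"
  shows "\<exists>z\<in>S. gdist G (q i j) z \<noteq> gdist G (q i' k) z"
proof -
  have "gdist G (q i j) (q i a) = ereal (real (cyc_dist (n i) j a))"
    "gdist G (q i' k) (q i a) = ereal (real (cyc_dist (n i') k 0 + 1))"
    "gdist G (q i j) (q i 0) = ereal (real (cyc_dist (n i) j 0))"
    "gdist G (q i' k) (q i 0) = ereal (real (cyc_dist (n i') k 0))"
    using assms by (simp_all add: gdist_q cyc_dist_eq_0_iff)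
  then have "gdist G (q i j) (q i a) \<noteq> gdist G (q i' k) (q i a) \<or>
    gdist G (q i j) (q i 0) \<noteq> gdist G (q i' k) (q i 0)"
    using assms by auto
  then show ?thesis using assms q_0[of i] by auto
qed

text \<open>
  One long cycle can do with a single chosen vertex, because of two vertices on different petals
  at most one lies on this cycle and \<open>different_cycles_resolved\<close> applies to the cycle of the other.
\<close>

lemma ex_connected_resolving_set:
  "\<exists>S. finite S \<and> connected_resolving_set G S \<and> card S \<le> m + 1 + (card long - 1)"
proof -
  \<comment> \<open>The exceptional long cycle; an arbitrary number if there is none, which then makes \<open>T\<close> empty.\<close>
  define e where "e = (SOME i. i \<in> long)"
  define T where "T = long - {e}"
  have fin: "finite long" by (simp add: long_def)
  have card_T: "card T = card long - 1"
  proof (cases "long = {}")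
    case False
    then have "e \<in> long" unfolding e_def by (auto intro: someI)
    then show ?thesis using fin by (simp add: T_def)
  qed (simp add: T_def)
  define S where "S = insert centre ((\<lambda>i. q i 1) ` {..<m} \<union> (\<lambda>i. q i (n i - 1)) ` T)"
  have T_less: "i < m" if "i \<in> T" for i using that by (simp add: T_def long_def)
  have finT: "finite T" using fin by (simp add: T_def)
  have centre_S: "centre \<in> S" and first_S: "q i 1 \<in> S" if "i < m" for i
    using that by (auto simp: S_def)
  have S_verts: "S \<subseteq> verts G"
  proof -
    have "q i 1 \<in> verts G" if "i < m" for i using q_in_verts three_le_n[OF that] that by simp
    moreover have "q i (n i - 1) \<in> verts G" if "i < m" for i using q_in_verts that by simp
    moreover have "centre \<in> verts G" using q_in_verts two_le_m by (simp add: centre_def)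
    ultimately show ?thesis using T_less by (auto simp: S_def)
  qed
  have pair: "\<exists>z\<in>S. gdist G (q i j) z \<noteq> gdist G (q i' k) z"
    if ij: "i < m" "0 < j" "j < n i" "i' < m" "0 < k" "k < n i'" "i \<noteq> i'" "i \<noteq> e" for i j i' k
  proof -
    have N: "3 \<le> n i" using ij three_le_n by blast
    have "\<exists>a<n i. q i a \<in> S \<and> cyc_dist (n i) j a \<le> cyc_dist (n i) j 0 \<and> cyc_dist (n i) 0 a = 1"
    proof (cases "i \<in> T")
      case True
      then have "q i (n i - 1) \<in> S" by (simp add: S_def)
      moreover have "cyc_dist (n i) 0 1 = 1" "cyc_dist (n i) 0 (n i - 1) = 1"
        using N by (auto simp: cyc_dist_le)
      moreover have "1 < n i" "n i - 1 < n i" using N by auto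
      ultimately show ?thesis
        using cyc_dist_nearer_neighbour[OF ij(2,3)] first_S[OF ij(1)] by (meson less_imp_le)
    next
      case False
      then have "n i = 3" using ij by (auto simp: T_def long_def)
      then show ?thesis
        using cyc_dist_triangle[of j] ij first_S[OF ij(1)]
        by (intro exI[of _ 1]) (simp add: cyc_dist_le)
    qed
    then show ?thesis
      using different_cycles_resolved[OF ij(1,3,4,6,7) centre_S[OF ij(1)]] by blast
  qed
  have "resolving_set G S"
    unfolding resolving_set_def
  proof (intro conjI ballI impI S_verts)
    fix x y assume xy: "x \<in> verts G" "y \<in> verts G" "x \<noteq> y"
    obtain i j where x: "i < m" "j < n i" "x = q i j" using xy(1) by (elim vertsE)
    obtain i' k where y: "i' < m" "k < n i'" "y = q i' k" using xy(2) by (elim vertsE)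
    \<comment> \<open>A centre vertex can be relabelled to lie on the same cycle as the other vertex.\<close>
    consider "i = i'" | "j = 0" | "k = 0" | "i \<noteq> i'" "0 < j" "0 < k" "i \<noteq> e"
      | "i \<noteq> i'" "0 < j" "0 < k" "i' \<noteq> e"
      by auto
    then show "\<exists>z\<in>S. gdist G x z \<noteq> gdist G y z"
    proof cases
      case 1
      then show ?thesis
        using same_cycle_resolved[of i j k S] x y xy centre_S[of i] first_S[of i] by auto
    next
      case 2
      then have "x = q i' 0" using x y by (simp add: q_0)
      then show ?thesis
        using same_cycle_resolved[of i' 0 k S] y xy centre_S[of i'] first_S[of i'] by auto
    next
      case 3
      then have "y = q i 0" using x y by (simp add: q_0)
      then show ?thesis
        using same_cycle_resolved[of i j 0 S] x xy centre_S[of i] first_S[of i] by auto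
    next
      case 4
      then show ?thesis using pair[of i j i' k] x y by simp
    next
      case 5
      then show ?thesis using pair[of i' k i j] x y by metis
    qed
  qed
  moreover have "Digraph_Component.connected (G \<restriction> S)"
  proof (rule connected_star)
    show "centre \<in> S" by (simp add: S_def)
  next
    fix v assume "v \<in> S" "v \<noteq> centre"
    then obtain i x where i: "i < m" "x = 1 \<or> x = n i - 1" "v = q i x"
      using T_less by (auto simp: S_def)
    have "x < n i" "cyc_adj (n i) x 0"
      using i three_le_n[of i] by (auto simp: cyc_adj_def Suc_mod_eq)
    then have "(q i x, q i 0) \<in> arcs_ends G" using i n_pos unfolding arcs_ends_eq by blast
    then show "(v, centre) \<in> arcs_ends G" using i by (simp add: q_0)
  qed
  moreover have "card S \<le> m + 1 + (card long - 1)"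
  proof -
    have "card S \<le> Suc (card ((\<lambda>i. q i 1) ` {..<m} \<union> (\<lambda>i. q i (n i - 1)) ` T))"
      unfolding S_def by (rule card_insert_le_m1) (auto)
    also have "\<dots> \<le> Suc (card ((\<lambda>i. q i 1) ` {..<m}) + card ((\<lambda>i. q i (n i - 1)) ` T))"
      using card_Un_le by (simp only: Suc_le_mono)
    also have "\<dots> \<le> Suc (m + card T)"
      using card_image_le[of "{..<m}" "\<lambda>i. q i 1"] card_image_le[OF finT, of "\<lambda>i. q i (n i - 1)"]
      by simp
    finally show ?thesis using card_T by simp
  qed
  moreover have "finite S" using finT by (simp add: S_def)
  ultimately show ?thesis unfolding connected_resolving_set_def by blast
qed

lemma cdim_eq: "cdim G = m + 1 + (card long - 1)"
  using ex_connected_resolving_set connected_resolving_set_card_ge cdim_eqI by metis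

end

section \<open>Coordinates for an arbitrary bouquet\<close>

lemma mod_add_right_cancel_nat: "(x + a) mod N = (y + a) mod N \<longleftrightarrow> x mod N = y mod (N :: nat)"
proof -
  have "(x + a) mod N = (y + a) mod N \<longleftrightarrow> int (x + a) mod int N = int (y + a) mod int N"
    by (simp only: zmod_int[symmetric] of_nat_eq_iff)
  also have "\<dots> \<longleftrightarrow> int x mod int N = int y mod int N"
    by (simp add: mod_eq_dvd_iff)
  also have "\<dots> \<longleftrightarrow> x mod N = y mod N"
    by (simp only: zmod_int[symmetric] of_nat_eq_iff)
  finally show ?thesis .
qed

lemma add_mod_adj:
  assumes "0 < N" "j < N" "k < N"
  shows "(k + a) mod N = Suc ((j + a) mod N) mod N \<longleftrightarrow> k = Suc j mod N"
proof -
  have "(k + a) mod N = Suc ((j + a) mod N) mod N \<longleftrightarrow> (k + a) mod N = (Suc j + a) mod N"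
    by (simp add: mod_Suc_eq)
  also have "\<dots> \<longleftrightarrow> k mod N = Suc j mod N"
    by (rule mod_add_right_cancel_nat)
  finally show ?thesis using assms by simp
qed

lemma digraph_iso_arcs:
  assumes "digraph_iso G H"
  obtains g where "inj_on g (verts G)" "verts H = g ` verts G"
    "arcs_ends H = map_prod g g ` arcs_ends G" "wf_digraph G" "wf_digraph H"
proof -
  obtain f where f: "pre_digraph.digraph_isomorphism G f" "H = app_iso f G"
    using assms by (auto simp: digraph_iso_def)
  then have wf: "wf_digraph G" by (simp add: pre_digraph.digraph_isomorphism_def)
  show thesis
  proof (rule that[of "iso_verts f"])
    show "inj_on (iso_verts f) (verts G)"
      using f(1) by (simp add: pre_digraph.digraph_isomorphism_def)
    show "arcs_ends H = map_prod (iso_verts f) (iso_verts f) ` arcs_ends G"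
      using wf_digraph.arcs_ends_app_iso_eq[OF wf f(1)] f(2) by (simp add: map_prod_def)
    show "wf_digraph H" using wf_digraph.wf_digraphI_app_iso[OF wf f(1)] f(2) by simp
  qed (use f wf in simp_all)
qed

lemma pverts_cycle_graph: "pverts (cycle_graph N) = {..<N}"
  by (simp add: cycle_graph_def)

text \<open>
  An isomorphism with \<open>C\<^sub>N\<close> numbers the vertices of \<open>C\<close>; rotating it makes the numbering start at \<open>r\<close>.
\<close>

lemma rotated_cycle_labelling:
  assumes "digraph_iso (with_proj C) (with_proj (cycle_graph N))" "r \<in> pverts C"
  shows "\<exists>p. bij_betw p {..<N} (pverts C) \<and> p 0 = r \<and>
    parcs C = {(p j, p k) | j k. j < N \<and> k < N \<and> cyc_adj N j k}"
proof -
  obtain g where g: "inj_on g (pverts C)" "{..<N} = g ` pverts C"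
    "parcs (cycle_graph N) = map_prod g g ` parcs C" and wf: "wf_digraph (with_proj C)"
    by (rule digraph_iso_arcs[OF assms(1), unfolded with_proj_simps pverts_cycle_graph]) (rule that)
  define a where "a = g r"
  have "a < N" using g(2) assms(2) unfolding a_def by blast
  then have "0 < N" by simp
  define rot where "rot j = (j + a) mod N" for j
  have "inj_on rot {..<N}"
  proof (rule inj_onI)
    fix j k assume "j \<in> {..<N}" "k \<in> {..<N}" "rot j = rot k"
    then have "j mod N = k mod N"
      by (simp add: rot_def mod_add_right_cancel_nat)
    then show "j = k" using \<open>j \<in> {..<N}\<close> \<open>k \<in> {..<N}\<close> by simp
  qed
  moreover have "rot ` {..<N} \<subseteq> {..<N}" using \<open>0 < N\<close> by (auto simp: rot_def)
  ultimately have rot: "bij_betw rot {..<N} {..<N}"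
    by (simp add: bij_betw_def endo_inj_surj)
  have g_inv: "bij_betw (the_inv_into (pverts C) g) {..<N} (pverts C)"
    using g(1,2) by (intro bij_betw_the_inv_into) (auto simp: bij_betw_def)
  define p where "p = the_inv_into (pverts C) g \<circ> rot"
  have p: "bij_betw p {..<N} (pverts C)"
    unfolding p_def using rot g_inv by (rule bij_betw_trans)
  have g_p: "g (p j) = rot j" if "j < N" for j
  proof -
    have "rot j \<in> g ` pverts C" using \<open>0 < N\<close> unfolding g(2)[symmetric] by (simp add: rot_def)
    then show ?thesis using f_the_inv_into_f[OF g(1)] by (simp add: p_def)
  qed
  have arcs: "(u, v) \<in> parcs C \<longleftrightarrow> (g u, g v) \<in> parcs (cycle_graph N)"
    if "u \<in> pverts C" "v \<in> pverts C" for u v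
  proof
    assume "(u, v) \<in> parcs C"
    then show "(g u, g v) \<in> parcs (cycle_graph N)" unfolding g(3) by force
  next
    assume "(g u, g v) \<in> parcs (cycle_graph N)"
    then obtain u' v' where uv: "(u', v') \<in> parcs C" "g u = g u'" "g v = g v'"
      unfolding g(3) by auto
    then have "u' \<in> pverts C" "v' \<in> pverts C"
      using wf_digraph.tail_in_verts[OF wf, of "(u', v')"]
        wf_digraph.head_in_verts[OF wf, of "(u', v')"] by auto
    then show "(u, v) \<in> parcs C" using uv g(1) that by (auto dest: inj_onD)
  qed
  have arcs_p: "(p j, p k) \<in> parcs C \<longleftrightarrow> cyc_adj N j k" if "j < N" "k < N" for j k
  proof -
    have "p j \<in> pverts C" "p k \<in> pverts C" using bij_betwE[OF p] that by auto
    then have "(p j, p k) \<in> parcs C \<longleftrightarrow> (rot j, rot k) \<in> parcs (cycle_graph N)"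
      using arcs g_p that by simp
    also have "\<dots> \<longleftrightarrow> cyc_adj N j k"
      using add_mod_adj[OF \<open>0 < N\<close>] that \<open>0 < N\<close>
      by (simp add: cycle_graph_def rot_def cyc_adj_def)
    finally show ?thesis .
  qed
  show ?thesis
  proof (intro exI[of _ p] conjI p)
    show "p 0 = r"
      using \<open>a < N\<close> the_inv_into_f_f[OF g(1) assms(2)] by (simp add: p_def rot_def a_def)
    have "\<exists>j k. u = p j \<and> v = p k \<and> j < N \<and> k < N" if "(u, v) \<in> parcs C" for u v
    proof -
      have "u \<in> p ` {..<N}" "v \<in> p ` {..<N}"
        using wf_digraph.tail_in_verts[OF wf, of "(u, v)"]
          wf_digraph.head_in_verts[OF wf, of "(u, v)"] that p by (auto simp: bij_betw_def)
      then show ?thesis by auto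
    qed
    then have "\<exists>j k. e = (p j, p k) \<and> j < N \<and> k < N \<and> cyc_adj N j k" if "e \<in> parcs C" for e
      using arcs_p that by (cases e) blast
    then show "parcs C = {(p j, p k) | j k. j < N \<and> k < N \<and> cyc_adj N j k}"
      using arcs_p by blast
  qed
qed

lemma digraph_iso_cycle_card:
  assumes "digraph_iso (with_proj C) (with_proj (cycle_graph N))"
  shows "card (pverts C) = N"
proof -
  obtain g where "inj_on g (pverts C)" "{..<N} = g ` pverts C"
    by (rule digraph_iso_arcs[OF assms, unfolded with_proj_simps pverts_cycle_graph]) (rule that)
  then show ?thesis by (metis card_image card_lessThan)
qed

text \<open>
  Number each cycle starting from its vertex to be glued, and carry the numbering through
  the gluing, which by disjointness of the cycles identifies just the positions 0, and then through
  the isomorphism with \<open>B\<close>.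
\<close>

lemma bouquet_labelling:
  assumes "2 \<le> m" and bouquet: "bouquet B m C r"
  obtains q where "labelled_bouquet B m (\<lambda>i. card (pverts (C i))) q"
proof -
  define N where "N i = card (pverts (C i))" for i
  have iso: "digraph_iso (with_proj (C i)) (with_proj (cycle_graph (N i)))" "3 \<le> N i" if i: "i < m" for i
  proof -
    obtain k where "3 \<le> k" "digraph_iso (with_proj (C i)) (with_proj (cycle_graph k))"
      using bouquet i by (auto simp: bouquet_def)
    then show "digraph_iso (with_proj (C i)) (with_proj (cycle_graph (N i)))" "3 \<le> N i"
      using digraph_iso_cycle_card by (auto simp: N_def)
  qed
  have r: "r i \<in> pverts (C i)" if "i < m" for i
    using bouquet that by (simp add: bouquet_def)
  have "\<forall>i. \<exists>p. i < m \<longrightarrow> bij_betw p {..<N i} (pverts (C i)) \<and> p 0 = r i \<and>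
    parcs (C i) = {(p j, p k) | j k. j < N i \<and> k < N i \<and> cyc_adj (N i) j k}"
    using rotated_cycle_labelling[OF iso(1) r] by blast
  from choice[OF this] obtain p where p: "\<And>i. i < m \<Longrightarrow> bij_betw (p i) {..<N i} (pverts (C i))"
    "\<And>i. i < m \<Longrightarrow> p i 0 = r i"
    "\<And>i. i < m \<Longrightarrow> parcs (C i) = {(p i j, p i k) | j k. j < N i \<and> k < N i \<and> cyc_adj (N i) j k}"
    by blast
  have N_pos: "0 < N i" if "i < m" for i using iso(2)[OF that] by simp
  have p_in: "p i j \<in> pverts (C i)" if "i < m" "j < N i" for i j
    using bij_betwE[OF p(1)[OF that(1)]] that(2) by simp
  have p_eq: "p i j = p i' j' \<longleftrightarrow> i = i' \<and> j = j'"
    if "i < m" "j < N i" "i' < m" "j' < N i'" for i j i' j'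
  proof
    assume eq: "p i j = p i' j'"
    have "i = i'"
    proof (rule ccontr)
      assume "i \<noteq> i'"
      then have "pverts (C i) \<inter> pverts (C i') = {}"
        using bouquet that by (auto simp: bouquet_def disjoint_family_on_def)
      then show False using eq p_in that by (metis disjoint_iff)
    qed
    then show "i = i' \<and> j = j'"
      using eq that inj_onD[OF bij_betw_imp_inj_on[OF p(1)[OF that(1)]], of j j'] by simp
  qed simp
  let ?gl = "glue m r"
  have gl: "?gl (p i j) = (if j = 0 then r 0 else p i j)" if "i < m" "j < N i" for i j
  proof -
    have "p i j \<in> r ` {..<m} \<longleftrightarrow> j = 0"
    proof
      assume "p i j \<in> r ` {..<m}"
      then obtain l where "l < m" "p i j = p l 0" using p(2) by auto
      then show "j = 0" using p_eq[of i j l 0] that N_pos by simp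
    qed (use that p(2) in auto)
    then show ?thesis by (simp add: glue_def)
  qed
  obtain g where g: "inj_on g (pverts (vertex_sum m C r))"
    "verts B = g ` pverts (vertex_sum m C r)"
    "arcs_ends B = map_prod g g ` parcs (vertex_sum m C r)" "wf_digraph B"
  proof -
    have "digraph_iso (with_proj (vertex_sum m C r)) B" using bouquet by (simp add: bouquet_def)
    then show thesis
      by (rule digraph_iso_arcs[of _ B]) (use that in simp)
  qed
  have verts_sum: "pverts (vertex_sum m C r) = {?gl (p i j) | i j. i < m \<and> j < N i}"
  proof -
    have "pverts (C i) = p i ` {..<N i}" if "i < m" for i
      using p(1)[OF that] by (simp add: bij_betw_def)
    then have "(\<Union>i<m. pverts (C i)) = {p i j | i j. i < m \<and> j < N i}" by auto
    then show ?thesis by (auto simp: vertex_sum_def)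
  qed
  have arcs_sum: "parcs (vertex_sum m C r) =
    {(?gl (p i j), ?gl (p i k)) | i j k. i < m \<and> j < N i \<and> k < N i \<and> cyc_adj (N i) j k}"
  proof -
    have "(\<Union>i<m. parcs (C i)) =
      {(p i j, p i k) | i j k. i < m \<and> j < N i \<and> k < N i \<and> cyc_adj (N i) j k}"
      using p(3) by auto
    then show ?thesis by (force simp: vertex_sum_def)
  qed
  define q where "q i j = g (?gl (p i j))" for i j
  interpret wf_digraph B by fact
  have "labelled_bouquet B m N q"
  proof unfold_locales
    show "verts B = {q i j | i j. i < m \<and> j < N i}"
      unfolding g(2) verts_sum q_def by auto
    show "arcs_ends B = {(q i j, q i k) | i j k. i < m \<and> j < N i \<and> k < N i \<and> cyc_adj (N i) j k}"
      unfolding g(3) arcs_sum q_def by force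
  next
    fix i j i' j' assume ij: "i < m" "j < N i" "i' < m" "j' < N i'"
    then have "q i j = q i' j' \<longleftrightarrow> ?gl (p i j) = ?gl (p i' j')"
      unfolding q_def verts_sum by (intro inj_on_eq_iff[OF g(1)[unfolded verts_sum]]) blast+
    also have "\<dots> \<longleftrightarrow> j = j' \<and> (i = i' \<or> j = 0)"
    proof -
      have "r 0 = p 0 0" "0 < m" using p(2) \<open>2 \<le> m\<close> by auto
      then show ?thesis
        using ij p_eq[of i j i' j'] p_eq[of 0 0 i' j'] p_eq[of i j 0 0] N_pos[of 0] by (auto simp: gl)
    qed
    finally show "q i j = q i' j' \<longleftrightarrow> j = j' \<and> (i = i' \<or> j = 0)" .
  qed (use \<open>2 \<le> m\<close> iso(2) in auto)
  then show thesis using that unfolding N_def by blast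
qed

theorem proposition5p12:
  fixes B :: "('b, 'c) pre_digraph"
    and C :: "nat \<Rightarrow> 'a pair_pre_digraph"
    and r :: "nat \<Rightarrow> 'a"
    and m b :: nat
  assumes "m \<ge> 2"
    and "bouquet B m C r"
    and "b = card {i. i < m \<and> digraph_iso (with_proj (C i)) (with_proj (cycle_graph 3))}"
  shows "cdim B = (if b = m then m + 1 else 2 * m - b)"
proof -
  obtain q where "labelled_bouquet B m (\<lambda>i. card (pverts (C i))) q"
    using bouquet_labelling[OF assms(1,2)] .
  then interpret labelled_bouquet B m "\<lambda>i. card (pverts (C i))" q .
  have triangle: "digraph_iso (with_proj (C i)) (with_proj (cycle_graph 3)) \<longleftrightarrow> card (pverts (C i)) = 3"
    if "i < m" for i
    using assms(2) that digraph_iso_cycle_card unfolding bouquet_def by metis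
  then have "{i. i < m \<and> digraph_iso (with_proj (C i)) (with_proj (cycle_graph 3))} = {..<m} - long"
    by (auto simp: long_def)
  moreover have "long \<subseteq> {..<m}" by (auto simp: long_def)
  ultimately have "b = m - card long" "card long \<le> m"
    using assms(3) card_mono[of "{..<m}" long] by (auto simp: card_Diff_subset finite_subset)
  then show ?thesis using cdim_eq by auto
qed

end
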